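(* Let $m\ge 1$ and $k\ge 2$ be integers and let $\#(n)$ be the number of different blocks of length $n$ allowed in the shift space $T_{m,k}$. Then (with the appropriate initial conditions, namely the values $\#(1),\dots,\#(m+1)$) the numbers $\#(n)$ satisfy the recurrence $$\#(n)=\#(n-1)+(k-1)\,\#(n-m-1)\qquad\text{for all } n\ge m+2.$$
   Context: For integers $m\ge 1$, $k\ge 2$, the shift space $T_{m,k}$ is the set of all bi-infinite sequences $(x_i)_{i\in\mathbb{Z}}$ over the alphabet $\{0,1,\dots,k-1\}$ in which each symbol other than $0$ appears isolated and is separated by at least $m$ $0$'s from any other occurrence of a nonzero symbol (i.e. any two nonzero entries are separated by at least $m$ zeros). A block of length $n$ is a finite sequence of $n$ consecutive symbols; it is allowed if it occurs in some sequence of the shift space. *)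

theory Defs
  imports Main
begin

definition shift_space :: "nat \<Rightarrow> nat \<Rightarrow> (int \<Rightarrow> nat) set" where
  "shift_space m k =
     {x. (\<forall>i. x i \<in> {0..<k}) \<and>
         (\<forall>i j. i < j \<and> x i \<noteq> 0 \<and> x j \<noteq> 0 \<longrightarrow> m \<le> card {l \<in> {i<..<j}. x l = 0})}"

definition occurs_in :: "'a list \<Rightarrow> (int \<Rightarrow> 'a) \<Rightarrow> bool" where
  "occurs_in w x \<longleftrightarrow> (\<exists>i. \<forall>j < length w. w ! j = x (i + int j))"

definition allowed_blocks :: "(int \<Rightarrow> 'a) set \<Rightarrow> nat \<Rightarrow> 'a list set" where
  "allowed_blocks X n = {w. length w = n \<and> (\<exists>x \<in> X. occurs_in w x)}"

definition num_blocks :: "nat \<Rightarrow> nat \<Rightarrow> nat \<Rightarrow> nat" where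
  "num_blocks m k n = card (allowed_blocks (shift_space m k) n)"

text \<open>The set counted by \<open>num_blocks\<close> is finite, so the cardinality is the genuine one.\<close>

lemma finite_allowed_blocks: "finite (allowed_blocks (shift_space m k) n)"
proof (rule finite_subset)
  show "allowed_blocks (shift_space m k) n \<subseteq> {w. set w \<subseteq> {0..<k} \<and> length w = n}"
    by (fastforce simp: allowed_blocks_def shift_space_def occurs_in_def in_set_conv_nth)
  show "finite {w. set w \<subseteq> {0..<k} \<and> length w = n}"
    by (rule finite_lists_length_eq) simp
qed

end

theory Submission
  imports Defs
begin

text \<open>A word is allowed iff its letters are below \<open>k\<close> and any two of its nonzero letters are more
  than \<open>m\<close> positions apart, since such a word extends by zeros on both sides. An allowed word of
  length \<open>n > m\<close> is either \<open>0\<close> followed by an allowed word of length \<open>n - 1\<close>, or one of the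
  \<open>k - 1\<close> nonzero letters followed by \<open>m\<close> zeros and an arbitrary allowed word of length
  \<open>n - m - 1\<close>.\<close>

definition spaced :: "nat \<Rightarrow> nat list \<Rightarrow> bool" where
  "spaced m w \<longleftrightarrow>
     (\<forall>a b. a < b \<and> b < length w \<and> w ! a \<noteq> 0 \<and> w ! b \<noteq> 0 \<longrightarrow> a + m < b)"

definition spaced_words :: "nat \<Rightarrow> nat \<Rightarrow> nat \<Rightarrow> nat list set" where
  "spaced_words m k n = {w. length w = n \<and> set w \<subseteq> {0..<k} \<and> spaced m w}"

text \<open>Prepending a letter shifts every position by one, so the constraint
  \<open>0 + m < Suc b\<close> against the new head becomes \<open>m \<le> b\<close>. A zero head
  adds no constraint.\<close>

lemma spaced_Cons:
  "spaced m (c # w) \<longleftrightarrow>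
     spaced m w \<and> (c \<noteq> 0 \<longrightarrow> (\<forall>b < length w. w ! b \<noteq> 0 \<longrightarrow> m \<le> b))"
proof
  assume L: "spaced m (c # w)"
  have "a + m < b" if "a < b" "b < length w" "w ! a \<noteq> 0" "w ! b \<noteq> 0" for a b
    using L[unfolded spaced_def, rule_format, of "Suc a" "Suc b"] that by simp
  moreover have "m \<le> b" if "c \<noteq> 0" "b < length w" "w ! b \<noteq> 0" for b
    using L[unfolded spaced_def, rule_format, of 0 "Suc b"] that by simp
  ultimately show "spaced m w \<and> (c \<noteq> 0 \<longrightarrow> (\<forall>b < length w. w ! b \<noteq> 0 \<longrightarrow> m \<le> b))"
    unfolding spaced_def by blast
next
  assume R: "spaced m w \<and> (c \<noteq> 0 \<longrightarrow> (\<forall>b < length w. w ! b \<noteq> 0 \<longrightarrow> m \<le> b))"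
  show "spaced m (c # w)"
    unfolding spaced_def
  proof (intro allI impI)
    fix a b
    assume "a < b \<and> b < length (c # w) \<and> (c # w) ! a \<noteq> 0 \<and> (c # w) ! b \<noteq> 0"
    then show "a + m < b"
      using R by (cases a; cases b) (auto simp: spaced_def)
  qed
qed

lemma spaced_replicate_append: "spaced m (replicate l 0 @ w) \<longleftrightarrow> spaced m w"
  by (induction l) (simp_all add: spaced_Cons)

text \<open>Trades the count of zeros for a distance. Only \<open>j - i - 1\<close> positions lie
  strictly between \<open>i\<close> and \<open>j\<close>, so \<open>m\<close> zeros there force the
  distance; the converse needs the distance condition for all pairs, not just for \<open>i\<close>
  and \<open>j\<close>.\<close>

lemma shift_space_iff:
  "x \<in> shift_space m k \<longleftrightarrow>
     (\<forall>i. x i < k) \<and> (\<forall>i j. i < j \<and> x i \<noteq> 0 \<and> x j \<noteq> 0 \<longrightarrow> i + int m < j)"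
proof -
  have "i + int m < j"
    if "i < j" "m \<le> card {l \<in> {i<..<j}. x l = 0}" for i j
  proof -
    have "card {l \<in> {i<..<j}. x l = 0} \<le> card {i<..<j}"
      by (rule card_mono) auto
    with that show ?thesis by simp
  qed
  moreover have "m \<le> card {l \<in> {i<..<j}. x l = 0}"
    if sp: "\<forall>i j. i < j \<and> x i \<noteq> 0 \<and> x j \<noteq> 0 \<longrightarrow> i + int m < j"
      and ij: "i < j" "x i \<noteq> 0" "x j \<noteq> 0" for i j
  proof -
    have "i + int m < j" using sp ij by blast
    \<comment> \<open>A nonzero entry among the \<open>m\<close> positions right after
      \<open>i\<close> would be too close to \<open>i\<close>, so these positions already supply
      \<open>m\<close> zeros.\<close>
    then have "{i<..i + int m} \<subseteq> {l \<in> {i<..<j}. x l = 0}"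
      using sp ij(2) by fastforce
    then have "card {i<..i + int m} \<le> card {l \<in> {i<..<j}. x l = 0}"
      by (rule card_mono[rotated]) (rule finite_subset[of _ "{i<..<j}"], auto)
    then show ?thesis by simp
  qed
  ultimately show ?thesis
    unfolding shift_space_def by (simp, blast)
qed

lemma allowed_blocks_shift_space:
  assumes "k > 0"
  shows "allowed_blocks (shift_space m k) n = spaced_words m k n"
proof
  show "allowed_blocks (shift_space m k) n \<subseteq> spaced_words m k n"
  proof
    fix w assume "w \<in> allowed_blocks (shift_space m k) n"
    then obtain x i where len: "length w = n" and x: "x \<in> shift_space m k"
      and w: "\<forall>j < length w. w ! j = x (i + int j)"
      by (auto simp: allowed_blocks_def occurs_in_def)
    have "set w \<subseteq> {0..<k}"
      using w x by (auto simp: in_set_conv_nth shift_space_iff)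
    moreover have "a + m < b" if "a < b" "b < length w" "w ! a \<noteq> 0" "w ! b \<noteq> 0" for a b
    proof -
      have "i + int a + int m < i + int b"
        using x[unfolded shift_space_iff, THEN conjunct2, rule_format, of "i + int a" "i + int b"]
          w that by simp
      then show ?thesis by simp
    qed
    ultimately show "w \<in> spaced_words m k n"
      using len by (auto simp: spaced_words_def spaced_def)
  qed
next
  show "spaced_words m k n \<subseteq> allowed_blocks (shift_space m k) n"
  proof
    fix w assume "w \<in> spaced_words m k n"
    then have len: "length w = n" and lt: "set w \<subseteq> {0..<k}" and sp: "spaced m w"
      by (auto simp: spaced_words_def)
    \<comment> \<open>Zero padding creates no new nonzero entries, so the spacing of
      \<open>w\<close> carries over; \<open>k > 0\<close> makes the padding symbol a legal
      letter.\<close>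
    define x where "x i = (if 0 \<le> i \<and> i < int n then w ! nat i else 0)" for i
    have "x i < k" for i
    proof (cases "0 \<le> i \<and> i < int n")
      case True
      then have "w ! nat i \<in> set w" using len by (intro nth_mem) linarith
      with lt True show ?thesis by (auto simp: x_def)
    qed (use assms in \<open>auto simp: x_def\<close>)
    moreover have "i + int m < j" if "i < j" "x i \<noteq> 0" "x j \<noteq> 0" for i j
    proof -
      have ij: "0 \<le> i" "j < int n" "w ! nat i \<noteq> 0" "w ! nat j \<noteq> 0"
        using that by (auto simp: x_def split: if_splits)
      then have "nat i + m < nat j"
        using sp[unfolded spaced_def, rule_format, of "nat i" "nat j"] \<open>i < j\<close> len by simp
      with ij \<open>i < j\<close> show ?thesis by linarith
    qed
    ultimately have "x \<in> shift_space m k"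
      by (simp add: shift_space_iff)
    moreover have "occurs_in w x"
      unfolding occurs_in_def by (rule exI[of _ 0]) (simp add: x_def len)
    ultimately show "w \<in> allowed_blocks (shift_space m k) n"
      using len by (auto simp: allowed_blocks_def)
  qed
qed

text \<open>The split is by the first letter. Writing the length as \<open>Suc (m + n)\<close>
  leaves room for a nonzero letter with all its \<open>m\<close> forced zeros, and avoids
  subtraction on naturals.\<close>

lemma spaced_words_decomp:
  assumes "k > 0"
  shows "spaced_words m k (Suc (m + n)) =
    (#) 0 ` spaced_words m k (m + n) \<union>
    (\<lambda>(c, w). c # replicate m 0 @ w) ` ({1..<k} \<times> spaced_words m k n)" (is "_ = ?A \<union> ?B")
proof
  show "spaced_words m k (Suc (m + n)) \<subseteq> ?A \<union> ?B"
  proof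
    fix v assume v: "v \<in> spaced_words m k (Suc (m + n))"
    then obtain c w where cw: "v = c # w"
      by (cases v) (auto simp: spaced_words_def)
    have w: "w \<in> spaced_words m k (m + n)" and c: "c < k"
      and gap: "c \<noteq> 0 \<Longrightarrow> \<forall>b < length w. w ! b \<noteq> 0 \<longrightarrow> m \<le> b"
      using v by (auto simp: cw spaced_words_def spaced_Cons)
    show "v \<in> ?A \<union> ?B"
    proof (cases "c = 0")
      case True
      then show ?thesis using w cw by blast
    next
      case False
      have len: "length w = m + n" using w by (simp add: spaced_words_def)
      \<comment> \<open>By \<open>gap\<close>, a nonzero head leaves only zeros at the first
        \<open>m\<close> positions of the tail.\<close>
      have "take m w = replicate m 0"
      proof (rule nth_equalityI)
        fix i assume "i < length (take m w)"
        then have "i < m" "i < length w" by simp_all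
        with gap[OF False] have "w ! i = 0" by (metis not_le)
        with \<open>i < m\<close> show "take m w ! i = replicate m 0 ! i" by simp
      qed (simp add: len)
      then have eq: "w = replicate m 0 @ drop m w"
        by (metis append_take_drop_id)
      moreover have "drop m w \<in> spaced_words m k n"
      proof -
        have "spaced m (drop m w)"
          using w eq spaced_replicate_append by (metis (lifting) mem_Collect_eq spaced_words_def)
        then show ?thesis
          using w set_drop_subset[of m w] by (auto simp: spaced_words_def)
      qed
      ultimately have "(c, drop m w) \<in> {1..<k} \<times> spaced_words m k n"
          "v = (\<lambda>(c, w). c # replicate m 0 @ w) (c, drop m w)"
        using False c cw by auto
      then show ?thesis by blast
    qed
  qed
next
  show "?A \<union> ?B \<subseteq> spaced_words m k (Suc (m + n))"
    using assms by (auto simp: spaced_words_def spaced_Cons spaced_replicate_append nth_append subset_iff)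
qed

lemma card_spaced_words:
  assumes "k > 0"
  shows "card (spaced_words m k (Suc (m + n))) =
    card (spaced_words m k (m + n)) + (k - 1) * card (spaced_words m k n)"
proof -
  have fin: "finite (spaced_words m k l)" for l
    using finite_allowed_blocks allowed_blocks_shift_space[OF assms] by metis
  let ?f = "\<lambda>(c, w). c # replicate m (0::nat) @ w"
  have "card (?f ` ({1..<k} \<times> spaced_words m k n)) = (k - 1) * card (spaced_words m k n)"
    by (subst card_image) (auto simp: inj_on_def card_cartesian_product)
  moreover have "card ((#) 0 ` spaced_words m k (m + n)) = card (spaced_words m k (m + n))"
    by (rule card_image) simp
  ultimately show ?thesis
    \<comment> \<open>The two parts are disjoint because their words start with \<open>0\<close> and
      with a letter from \<open>{1..<k}\<close>, respectively.\<close>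
    unfolding spaced_words_decomp[OF assms]
    by (subst card_Un_disjoint) (auto simp: fin)
qed

theorem lemma4:
  fixes m k :: nat
  assumes "m \<ge> 1" and "k \<ge> 2"
  shows "\<forall>n \<ge> m + 2. num_blocks m k n = num_blocks m k (n - 1) + (k - 1) * num_blocks m k (n - m - 1)"
proof (intro allI impI)
  fix n assume "m + 2 \<le> n"
  \<comment> \<open>With this \<open>l\<close>, the lengths \<open>n - 1\<close> and
    \<open>n - m - 1\<close> simplify to \<open>m + l\<close> and \<open>l\<close>.\<close>
  then obtain l where "n = Suc (m + l)"
    by (metis add_2_eq_Suc' add_Suc_right add_Suc_shift le_iff_add)
  moreover have "k > 0" using assms(2) by simp
  ultimately show "num_blocks m k n =
      num_blocks m k (n - 1) + (k - 1) * num_blocks m k (n - m - 1)"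
    by (simp add: num_blocks_def allowed_blocks_shift_space card_spaced_words)
qed

end
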